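(* Assume that, for each review epoch $r$, scalar belief $m$ and continuation side $a\in\{0,1\}$: (B1) $\Phi_r^a(\cdot;m)$ is proper, lower semicontinuous and convex on $[0,\infty)$ and attains a minimum on this domain; (B2) the predictive distribution of $D_r$ under $m$ has a continuous distribution function $F_r(\cdot\mid m)$; (B3) the continuation term $\Xi_r^a(\cdot;m)$ is convex on $[0,\infty)$ and differentiable at the interior capacity levels at which its derivative is used below, and at kink points its convex subdifferential is nonempty. For $a\in\{0,1\}$ let $\bar y_r^a(m)$ be the smallest element of $\arg\min_{y\ge0}\Phi_r^a(y;m)$. Then, conditional on continuation side $a$, the optimal deployment quantity (smallest minimizer of $O_r^a(\cdot;m,I)$ over $[0,\bar q_r]$) is $$q_r^{a*}(m,I)=\min\left\{\bar q_r,\ [\bar y_r^a(m)-I]^+\right\},\qquad a\in\{0,1\}.$$ If there is no upper deployment bound, then $q_r^{a*}(m,I)=[\bar y_r^a(m)-I]^+$. If $\bar y_r^a(m)>0$ is an interior minimizer, $\Xi_r^a(\cdot;m)$ is differentiable at $\bar y_r^a(m)$, and the right-hand side below is well defined ($b+h>0$) and lies in $[0,1]$, then $$F_r(\bar y_r^a(m)\mid m)=\frac{b-c_r-\partial_y\Xi_r^a(\bar y_r^a(m);m)}{b+h}.$$ If instead $\bar y_r^a(m)>0$ is a kink point of $\Xi_r^a(\cdot;m)$, the optimality condition is $$0\in c_r+hF_r(\bar y_r^a(m)\mid m)-b\left[1-F_r(\bar y_r^a(m)\mid m)\right]+\partial\Xi_r^a(\bar y_r^a(m);m),$$ where $\partial\Xi_r^a$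 is the convex subdifferential in $y$. If the global target is zero, or if the implemented capacity level $y=I+q_r^{a*}(m,I)$ reaches a boundary of its feasible set, the corresponding one-sided or normal-cone optimality condition replaces the fractile equation, namely $$0\in c_r+hF_r(y\mid m)-b\left[1-F_r(y\mid m)\right]+\partial\Xi_r^a(y;m)+N_C(y),$$ with $y=\bar y_r^a(m)=0$ and $C=[0,\infty)$ in the former case, and $y=I+q_r^{a*}(m,I)$ and $C=[I,I+\bar q_r]$ in the latter, $N_C(y)$ denoting the normal cone of $C$ at $y$.
   Context: Model. A firm reviews service capacity at epochs $r=1,\ldots,R$. $D_r\ge0$ is the random workload demand in the interval after review $r$ and $I\ge0$ is the serviceable capacity at the beginning of the review. If the response channel is open, the firm chooses a deployment quantity $q\in[0,\bar q_r]$ ($\bar q_r>0$) at unit cost $c_r$ and a next channel state $a\in\{0,1\}$ ($a=1$ preserve, $a=0$ close; this is the "continuation side"). A closed channel stays closed and permits no further deployment; a readiness cost $k_r$ is paid at review $r$ iff $a=1$. The unit idle-capacity cost is $h\ge0$ and the unit shortage penalty is $b\ge0$; the operating cost is $\ell_r(I,q,D_r)=h[I+q-D_r]^++b[D_r-I-q]^+$, $[x]^+=\max\{x,0\}$. The belief about remaining workload is a scalar $m\in\mathcal M_r$, $\mathcal M_r\subseteq\mathbb R$ an interval, determining the predictive law of $D_r$; $\mathbb E_m$ denotes expectation under $m$. Post-deployment capacity is $y=I+q$. The capacity transition depends on $(I,q)$ only through $y$: $g_r(I,q)=\widetilde g_r(I+q)=\widetilde g_r(y)$. Served workload is $X_r(y)=\min\{D_r,y\}$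 and the next scalar belief is $m_{r+1}(y)=\mathcal B_r(m,X_r(y),y)$ for a given update map $\mathcal B_r$. Value functions: $V_{R+1}^0=V_{R+1}^1=0$, $$O_r^a(q;m,I)=c_rq+\mathbb E_m\big[\ell_r(I,q,D_r)+V_{r+1}^a(m_{r+1}(I+q),\widetilde g_r(I+q))\big],$$ $$V_r^0(m,I)=O_r^0(0;m,I),\qquad V_r^1(m,I)=\min\Big\{\min_{q\in[0,\bar q_r]}O_r^0(q;m,I),\ k_r+\min_{q\in[0,\bar q_r]}O_r^1(q;m,I)\Big\}.$$ Stage costs are measurable and integrable, transitions are measurable kernels, and Bellman expectations are finite. Define $$\Xi_r^a(y;m)=\mathbb E_m\big[V_{r+1}^a(m_{r+1}(y),\widetilde g_r(y))\big],$$ $$\Phi_r^a(y;m)=c_ry+\mathbb E_m\big[h(y-D_r)^++b(D_r-y)^+\big]+\Xi_r^a(y;m),$$ so that $O_r^a(q;m,I)=-c_rI+\Phi_r^a(I+q;m)$. The quantity $q_r^{a*}(m,I)$ is the smallest minimizer of $O_r^a(\cdot;m,I)$ over the feasible deployment set. *)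

theory Defs
  imports "HOL-Probability.Probability"
begin

section \<open>Convex-analytic notions on the real line\<close>

definition lsc_on :: "real set \<Rightarrow> (real \<Rightarrow> real) \<Rightarrow> bool" where
  "lsc_on S f \<longleftrightarrow> (\<forall>x\<in>S. \<forall>u<f x. \<forall>\<^sub>F z in at x within S. u < f z)"

text \<open>The subdifferential at \<open>x\<close> of the convex function that equals \<open>f\<close> on \<open>S\<close>
  and \<open>+\<infinity>\<close> elsewhere.\<close>
definition subdifferential_on :: "real set \<Rightarrow> (real \<Rightarrow> real) \<Rightarrow> real \<Rightarrow> real set" where
  "subdifferential_on S f x = {s. x \<in> S \<and> (\<forall>z\<in>S. f x + s * (z - x) \<le> f z)}"

definition normal_cone :: "real set \<Rightarrow> real \<Rightarrow> real set" where
  "normal_cone C x = {n. x \<in> C \<and> (\<forall>z\<in>C. n * (z - x) \<le> 0)}"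

definition is_smallest_minimizer :: "(real \<Rightarrow> real) \<Rightarrow> real set \<Rightarrow> real \<Rightarrow> bool" where
  "is_smallest_minimizer f S x \<longleftrightarrow>
     is_arg_min f (\<lambda>z. z \<in> S) x \<and> (\<forall>x'. is_arg_min f (\<lambda>z. z \<in> S) x' \<longrightarrow> x \<le> x')"

definition smallest_minimizer :: "(real \<Rightarrow> real) \<Rightarrow> real set \<Rightarrow> real" where
  "smallest_minimizer f S = (THE x. is_smallest_minimizer f S x)"


section \<open>The capacity model\<close>

text \<open>Reviews are \<open>r \<in> {1..horizon}\<close>. The predictive law of the demand \<open>D\<^sub>r\<close> under belief \<open>m\<close>
  is \<open>demand_law r m\<close>; an upper bound \<open>max_deploy r = \<infinity>\<close> means that deployment at review \<open>r\<close>
  is unbounded. \<open>belief_update r m x y\<close> is the next belief after serving \<open>x\<close> at post-deployment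
  capacity \<open>y\<close>, and \<open>capacity_next r y\<close> is the next serviceable capacity.\<close>
record service_model =
  horizon :: nat
  unit_cost :: "nat \<Rightarrow> real"
  readiness_cost :: "nat \<Rightarrow> real"
  max_deploy :: "nat \<Rightarrow> ereal"
  idle_cost :: real
  shortage_cost :: real
  beliefs :: "nat \<Rightarrow> real set"
  demand_law :: "nat \<Rightarrow> real \<Rightarrow> real measure"
  belief_update :: "nat \<Rightarrow> real \<Rightarrow> real \<Rightarrow> real \<Rightarrow> real"
  capacity_next :: "nat \<Rightarrow> real \<Rightarrow> real"

definition deployments :: "service_model \<Rightarrow> nat \<Rightarrow> real set" where
  "deployments M r = {q. 0 \<le> q \<and> ereal q \<le> max_deploy M r}"

definition capacity_levels :: "service_model \<Rightarrow> nat \<Rightarrow> real \<Rightarrow> real set" where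
  "capacity_levels M r I = (\<lambda>q. I + q) ` deployments M r"

lemma capacity_levels_bounded:
  "max_deploy M r = ereal qbar \<Longrightarrow> capacity_levels M r I = {I..I + qbar}"
  by (force simp: capacity_levels_def deployments_def image_iff intro: exI[of _ "_ - I"])

lemma capacity_levels_unbounded:
  "max_deploy M r = \<infinity> \<Longrightarrow> capacity_levels M r I = {I..}"
  by (force simp: capacity_levels_def deployments_def image_iff intro: exI[of _ "_ - I"])

definition operating_cost :: "service_model \<Rightarrow> real \<Rightarrow> real \<Rightarrow> real \<Rightarrow> real" where
  "operating_cost M I q d =
     idle_cost M * max (I + q - d) 0 + shortage_cost M * max (d - I - q) 0"

definition next_value ::
    "service_model \<Rightarrow> nat \<Rightarrow> (real \<Rightarrow> real \<Rightarrow> real) \<Rightarrow> real \<Rightarrow> real \<Rightarrow> real \<Rightarrow> real" where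
  "next_value M r W m y d = W (belief_update M r m (min d y) y) (capacity_next M r y)"

definition stage_objective ::
    "service_model \<Rightarrow> nat \<Rightarrow> (real \<Rightarrow> real \<Rightarrow> real) \<Rightarrow> real \<Rightarrow> real \<Rightarrow> real \<Rightarrow> real" where
  "stage_objective M r W m I q = unit_cost M r * q +
     (\<integral>d. (operating_cost M I q d + next_value M r W m (I + q) d) \<partial>demand_law M r m)"

text \<open>\<open>val_fn M r a m I\<close> is the value \<open>V\<^sub>r\<^sup>a(m, I)\<close>, where the channel state \<open>a = True\<close> stands
  for \<open>1\<close> (open) and \<open>a = False\<close> for \<open>0\<close> (closed). The minima over \<open>q\<close> are written as infima;
  they are attained whenever the objectives, as functions of \<open>I + q\<close>, are convex and lower
  semicontinuous and attain a minimum on \<open>[0, \<infinity>)\<close>. \<open>stage_objective M r W m I q\<close> is the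
  expected cost of deploying \<open>q\<close> when the value function of the next review is \<open>W\<close>.\<close>
function val_fn :: "service_model \<Rightarrow> nat \<Rightarrow> bool \<Rightarrow> real \<Rightarrow> real \<Rightarrow> real" where
  "val_fn M r a =
     (if r > horizon M then (\<lambda>m I. 0)
      else if a then
        (\<lambda>m I. min
           (INF q\<in>deployments M r. stage_objective M r (val_fn M (Suc r) False) m I q)
           (readiness_cost M r +
            (INF q\<in>deployments M r. stage_objective M r (val_fn M (Suc r) True) m I q)))
      else (\<lambda>m I. stage_objective M r (val_fn M (Suc r) False) m I 0))"
  by pat_completeness auto
termination
  by (relation "Wellfounded.measure (\<lambda>(M, r, a). Suc (horizon M) - r)") auto

declare val_fn.simps [simp del]

definition objective ::
    "service_model \<Rightarrow> nat \<Rightarrow> bool \<Rightarrow> real \<Rightarrow> real \<Rightarrow> real \<Rightarrow> real" where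
  "objective M r a m I q = stage_objective M r (val_fn M (Suc r) a) m I q"

definition Xi :: "service_model \<Rightarrow> nat \<Rightarrow> bool \<Rightarrow> real \<Rightarrow> real \<Rightarrow> real" where
  "Xi M r a m y = (\<integral>d. next_value M r (val_fn M (Suc r) a) m y d \<partial>demand_law M r m)"

definition Phi :: "service_model \<Rightarrow> nat \<Rightarrow> bool \<Rightarrow> real \<Rightarrow> real \<Rightarrow> real" where
  "Phi M r a m y = unit_cost M r * y +
     (\<integral>d. (idle_cost M * max (y - d) 0 + shortage_cost M * max (d - y) 0) \<partial>demand_law M r m) +
     Xi M r a m y"

definition target :: "service_model \<Rightarrow> nat \<Rightarrow> bool \<Rightarrow> real \<Rightarrow> real" where
  "target M r a m = smallest_minimizer (Phi M r a m) {0..}"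

definition opt_deployment :: "service_model \<Rightarrow> nat \<Rightarrow> bool \<Rightarrow> real \<Rightarrow> real \<Rightarrow> real" where
  "opt_deployment M r a m I = smallest_minimizer (objective M r a m I) (deployments M r)"

abbreviation demand_cdf :: "service_model \<Rightarrow> nat \<Rightarrow> real \<Rightarrow> real \<Rightarrow> real" where
  "demand_cdf M r m \<equiv> cdf (demand_law M r m)"

text \<open>The last two conjuncts state that stage costs and Bellman expectations are finite; the
  Bochner integrals above would otherwise silently be \<open>0\<close>. Since served workload is
  \<open>min D\<^sub>r y\<close>, beliefs are only updated at \<open>0 \<le> x \<le> y\<close>.\<close>
definition well_formed_model :: "service_model \<Rightarrow> bool" where
  "well_formed_model M \<longleftrightarrow>
     0 \<le> idle_cost M \<and> 0 \<le> shortage_cost M \<and>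
     (\<forall>r\<in>{1..horizon M}.
        0 < max_deploy M r \<and>
        is_interval (beliefs M r) \<and>
        demand_law M r \<in> restrict_space borel (beliefs M r) \<rightarrow>\<^sub>M prob_algebra borel \<and>
        (\<forall>m\<in>beliefs M r. AE d in demand_law M r m. 0 \<le> d) \<and>
        (\<lambda>(m, x, y). belief_update M r m x y) \<in>
          borel_measurable (restrict_space borel {(m, x, y). m \<in> beliefs M r \<and> 0 \<le> x \<and> x \<le> y}) \<and>
        (r < horizon M \<longrightarrow> (\<forall>m\<in>beliefs M r. \<forall>x y. 0 \<le> x \<and> x \<le> y \<longrightarrow>
           belief_update M r m x y \<in> beliefs M (Suc r))) \<and>
        capacity_next M r \<in> borel_measurable (restrict_space borel {0..}) \<and>
        (\<forall>y\<ge>0. 0 \<le> capacity_next M r y) \<and>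
        (\<forall>m\<in>beliefs M r. \<forall>I\<ge>0. \<forall>q\<in>deployments M r.
           integrable (demand_law M r m) (operating_cost M I q)) \<and>
        (\<forall>m\<in>beliefs M r. \<forall>a. \<forall>y\<ge>0.
           integrable (demand_law M r m) (next_value M r (val_fn M (Suc r) a) m y)))"

end

(* Convexity of \<Phi> makes the projection of its smallest minimizer onto the feasible interval the
   smallest feasible minimizer, which is the base-stock formula. For the first-order conditions
   write G y = h F(y) - b (1 - F(y)). This is a subgradient of the expected stage cost at every y,
   and it is continuous because F is. Comparing a minimizer y over C with y + t (z - y) and letting
   t tend to 0 shows that - c - G y is a subgradient on C of the continuation term alone; it splits
   into a subgradient on [0, \<infinity>) and a normal vector of C. *)
theory Submission
  imports Defs
begin

section \<open>Smallest minimizers of convex functions\<close>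

text \<open>Being leftmost among minimizers amounts to a strict inequality on the left, so no
  reasoning about the set of minimizers is left.\<close>

lemma is_smallest_minimizer_iff:
  "is_smallest_minimizer f S x \<longleftrightarrow>
     x \<in> S \<and> (\<forall>z\<in>S. f x \<le> f z) \<and> (\<forall>z\<in>S. z < x \<longrightarrow> f x < f z)"
proof
  assume L: "is_smallest_minimizer f S x"
  then have x: "x \<in> S" and min: "\<forall>z\<in>S. f x \<le> f z"
    by (auto simp: is_smallest_minimizer_def is_arg_min_linorder)
  have "f x < f z" if "z \<in> S" "z < x" for z
  proof (rule ccontr)
    assume "\<not> f x < f z"
    then have "is_arg_min f (\<lambda>z. z \<in> S) z"
      using min that by (force simp: is_arg_min_linorder)
    then show False
      using L that by (auto simp: is_smallest_minimizer_def not_le[symmetric])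
  qed
  with x min show "x \<in> S \<and> (\<forall>z\<in>S. f x \<le> f z) \<and> (\<forall>z\<in>S. z < x \<longrightarrow> f x < f z)"
    by blast
next
  assume "x \<in> S \<and> (\<forall>z\<in>S. f x \<le> f z) \<and> (\<forall>z\<in>S. z < x \<longrightarrow> f x < f z)"
  then show "is_smallest_minimizer f S x"
    unfolding is_smallest_minimizer_def is_arg_min_linorder by (meson not_le)
qed

lemma smallest_minimizer_eq:
  assumes "is_smallest_minimizer f S x"
  shows "smallest_minimizer f S = x"
  unfolding smallest_minimizer_def
proof (rule the_equality)
  show "is_smallest_minimizer f S x" by (rule assms)
  show "x' = x" if "is_smallest_minimizer f S x'" for x'
    using assms that by (auto simp: is_smallest_minimizer_def intro: antisym)
qed

text \<open>The candidate is the infimum \<open>i\<close> of the sublevel set of the minimal value,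
  bounded below by \<open>c\<close>. If \<open>f i\<close> were larger than this value, lower
  semicontinuity would keep \<open>f\<close> larger near \<open>i\<close>, while the sublevel set
  has points arbitrarily close to its infimum.\<close>

lemma lsc_on_smallest_minimizer:
  assumes lsc: "lsc_on {c..} f" and ex: "is_arg_min f (\<lambda>z. z \<in> {c..}) y0"
  shows "is_smallest_minimizer f {c..} (smallest_minimizer f {c..})"
proof -
  have y0: "c \<le> y0" and min: "\<And>z. c \<le> z \<Longrightarrow> f y0 \<le> f z"
    using ex by (auto simp: is_arg_min_linorder)
  define A where "A = {y. c \<le> y \<and> f y \<le> f y0}"
  have A: "y0 \<in> A" "bdd_below A"
    using y0 by (auto simp: A_def intro!: bdd_belowI[of _ c])
  define i where "i = Inf A"
  have ci: "c \<le> i"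
    unfolding i_def using A by (intro cInf_greatest) (auto simp: A_def)
  have "f i \<le> f y0"
  proof (rule ccontr)
    assume "\<not> f i \<le> f y0"
    then have "\<forall>\<^sub>F z in at i within {c..}. f y0 < f z" and ni: "i \<notin> A"
      using lsc ci by (auto simp: lsc_on_def A_def)
    then obtain d where d: "d > 0" "\<And>z. z \<in> {c..} \<Longrightarrow> z \<noteq> i \<Longrightarrow> dist z i < d \<Longrightarrow> f y0 < f z"
      by (auto simp: eventually_at)
    obtain z where z: "z \<in> A" "z < i + d"
      using cInf_lessD[of A "i + d"] A d(1) by (auto simp: i_def)
    have "i \<le> z"
      unfolding i_def using z A by (intro cInf_lower)
    with z d(2)[of z] ni show False
      by (auto simp: A_def dist_real_def)
  qed
  have "is_smallest_minimizer f {c..} i"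
    unfolding is_smallest_minimizer_iff
  proof (intro conjI ballI impI)
    show "i \<in> {c..}" using ci by simp
    show "f i \<le> f z" if "z \<in> {c..}" for z
      using min[of z] that \<open>f i \<le> f y0\<close> by simp
    show "f i < f z" if "z \<in> {c..}" "z < i" for z
    proof -
      have "z \<notin> A"
        using cInf_lower[OF _ A(2), of z] that by (auto simp: i_def)
      with that \<open>f i \<le> f y0\<close> show ?thesis by (auto simp: A_def)
    qed
  qed
  then show ?thesis
    using smallest_minimizer_eq by metis
qed

lemma convex_on_between_le:
  fixes f :: "real \<Rightarrow> real"
  assumes f: "convex_on S f" and S: "y \<in> S" "z \<in> S" and fyz: "f y \<le> f z"
    and p: "p \<in> closed_segment y z"
  shows "f p \<le> f z"
proof -
  obtain u where u: "0 \<le> u" "u \<le> 1" "p = (1 - u) *\<^sub>R y + u *\<^sub>R z"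
    using p by (auto simp: closed_segment_def)
  have "f p \<le> (1 - u) * f y + u * f z"
    using convex_onD[OF f u(1,2) S] u(3) by simp
  also have "\<dots> \<le> (1 - u) * f z + u * f z"
    using fyz u by (intro add_right_mono mult_left_mono) auto
  finally show ?thesis by (simp add: algebra_simps)
qed

lemma convex_on_between_less:
  fixes f :: "real \<Rightarrow> real"
  assumes f: "convex_on S f" and S: "y \<in> S" "z \<in> S" and fyz: "f y < f z"
    and p: "p \<in> closed_segment y z" "p \<noteq> z"
  shows "f p < f z"
proof -
  obtain u where u: "0 \<le> u" "u \<le> 1" "p = (1 - u) *\<^sub>R y + u *\<^sub>R z"
    using p by (auto simp: closed_segment_def)
  then have "u < 1" using p(2) by (cases "u = 1") auto
  have "f p \<le> (1 - u) * f y + u * f z"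
    using convex_onD[OF f u(1,2) S] u(3) by simp
  also have "\<dots> < (1 - u) * f z + u * f z"
    using fyz \<open>u < 1\<close> by (intro add_strict_right_mono mult_strict_left_mono) auto
  finally show ?thesis by (simp add: algebra_simps)
qed

text \<open>To the right of a minimizer a convex function is nondecreasing, so a ray starting there
  is best at its left end; otherwise \<open>y\<close> itself is feasible.\<close>

lemma convex_smallest_minimizer_atLeast:
  assumes f: "convex_on {c..} f" and y: "is_smallest_minimizer f {c..} y" and I: "c \<le> I"
  shows "is_smallest_minimizer f {I..} (max y I)"
proof (cases "y \<le> I")
  case True
  have "f I \<le> f z" if "I \<le> z" for z
    by (rule convex_on_between_le[OF f, of y])
      (use y True I that in \<open>auto simp: is_smallest_minimizer_iff closed_segment_eq_real_ivl\<close>)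
  with True show ?thesis
    by (auto simp: is_smallest_minimizer_iff max_def)
next
  case False
  with y I show ?thesis by (auto simp: is_smallest_minimizer_iff max_def)
qed

text \<open>If \<open>y\<close> exceeds \<open>J\<close>, then \<open>f\<close> is strictly
  decreasing up to \<open>y\<close>, because \<open>y\<close> is the smallest minimizer, and
  \<open>J\<close> is the only minimizer on the interval. Otherwise the minimizer on the ray already
  lies below \<open>J\<close>.\<close>

lemma convex_smallest_minimizer_atLeastAtMost:
  assumes f: "convex_on {c..} f" and y: "is_smallest_minimizer f {c..} y"
    and I: "c \<le> I" "I \<le> J"
  shows "is_smallest_minimizer f {I..J} (min J (max y I))"
proof (cases "y \<le> J")
  case True
  then show ?thesis
    using convex_smallest_minimizer_atLeast[OF f y I(1)] I(2)
    by (auto simp: is_smallest_minimizer_iff min_def max_def)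
next
  case False
  have less: "f J < f z" if "z \<in> {I..J}" "z < J" for z
    by (rule convex_on_between_less[OF f, of y])
      (use y False I that in \<open>auto simp: is_smallest_minimizer_iff closed_segment_eq_real_ivl\<close>)
  then have "f J \<le> f z" if "z \<in> {I..J}" for z
    using that by (cases "z = J") (auto intro: less_imp_le)
  with False I less show ?thesis
    by (auto simp: is_smallest_minimizer_iff min_def max_def)
qed

text \<open>Passes from post-deployment capacity to the deployment quantity; the constant
  \<open>k\<close>, later \<open>unit_cost M r * I\<close>, does not move minimizers.\<close>

lemma is_smallest_minimizer_translate:
  assumes x: "is_smallest_minimizer f ((\<lambda>q. c + q) ` S) x"
    and g: "\<And>q. q \<in> S \<Longrightarrow> g q = f (c + q) - k"
  shows "is_smallest_minimizer g S (x - c)"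
proof -
  have "x - c \<in> S"
    using x by (auto simp: is_smallest_minimizer_iff)
  with x show ?thesis
    by (auto simp: is_smallest_minimizer_iff g less_diff_eq add.commute)
qed


section \<open>Subgradients on the line\<close>

text \<open>Difference quotients of a convex function grow away from \<open>y\<close>, so a slope
  that supports \<open>f\<close> at a nearer point supports it further out in the same
  direction.\<close>

lemma convex_on_subgradient_extend:
  fixes f :: "real \<Rightarrow> real"
  assumes f: "convex_on S f" and S: "y \<in> S" "z \<in> S" and t: "0 < t" "t \<le> 1"
    and s: "f y + s * (t * (z - y)) \<le> f (y + t * (z - y))"
  shows "f y + s * (z - y) \<le> f z"
proof -
  have "f (y + t * (z - y)) \<le> (1 - t) * f y + t * f z"
    using convex_onD[OF f _ t(2) S] t(1) by (simp add: algebra_simps)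
  with s have "t * (f y + s * (z - y)) \<le> t * f z"
    by (simp add: algebra_simps)
  with t show ?thesis by simp
qed

text \<open>The sign condition puts \<open>u\<close> and \<open>z\<close> on the same side of
  \<open>y\<close>. Some point lies on both segments from \<open>y\<close>; there the inequality is
  known from \<open>C\<close>, and convexity carries it out to \<open>z\<close>.\<close>

lemma convex_on_subgradient_ray:
  fixes f :: "real \<Rightarrow> real"
  assumes f: "convex_on S f" and C: "C \<subseteq> S" "is_interval C"
    and s: "s \<in> subdifferential_on C f y"
    and u: "u \<in> C" and z: "z \<in> S" "0 < (u - y) * (z - y)"
  shows "f y + s * (z - y) \<le> f z"
proof -
  have y: "y \<in> C" "\<forall>z\<in>C. f y + s * (z - y) \<le> f z"
    using s by (auto simp: subdifferential_on_def)
  define q where "q = (u - y) / (z - y)"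
  have q: "0 < q" "u = y + q * (z - y)"
    using z(2) by (auto simp: q_def zero_less_mult_iff zero_less_divide_iff)
  \<comment> \<open>The bound \<open>q\<close> keeps the test point between \<open>y\<close> and
    \<open>u\<close>, hence in \<open>C\<close>; the bound 1 keeps it between \<open>y\<close> and
    \<open>z\<close>.\<close>
  define t where "t = min 1 q"
  have t: "0 < t" "t \<le> 1" "t \<le> q" using q(1) by (auto simp: t_def)
  have "y + t * (z - y) = (1 - t / q) *\<^sub>R y + (t / q) *\<^sub>R u"
    using q(1) by (simp add: q(2) field_simps)
  then have "y + t * (z - y) \<in> closed_segment y u"
    using q(1) t unfolding closed_segment_def by (auto intro!: exI[of _ "t / q"])
  then have "y + t * (z - y) \<in> C"
    using y(1) u C(2) by (meson closed_segment_subset is_interval_convex subsetD)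
  then show ?thesis
    using y C z(1) t by (intro convex_on_subgradient_extend[OF f _ _ t(1,2)]) force+
qed

lemma convex_on_interior_subgradient:
  fixes f :: "real \<Rightarrow> real"
  assumes f: "convex_on S f" and y: "y \<in> interior S"
  obtains s where "s \<in> subdifferential_on S f y"
proof
  \<comment> \<open>This infimum of difference quotients is the right derivative at
    \<open>y\<close>.\<close>
  show "Inf ((\<lambda>t. (f y - f t) / (y - t)) ` ({y<..} \<inter> S)) \<in> subdifferential_on S f y"
    using convex_le_Inf_differential[OF f y] interior_subset y
    by (auto simp: subdifferential_on_def)
qed

text \<open>The sum rule \<open>\<partial>(f + \<delta>\<^sub>C) \<subseteq> \<partial>f + N\<^sub>C\<close> for the indicator \<open>\<delta>\<^sub>C\<close> of an interval.\<close>

lemma subdifferential_on_add_normal_cone: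
  fixes f :: "real \<Rightarrow> real"
  assumes f: "convex_on S f" and C: "C \<subseteq> S" "is_interval C" and y: "y \<in> interior S"
    and s: "s \<in> subdifferential_on C f y"
  obtains s' where "s' \<in> subdifferential_on S f y" "s - s' \<in> normal_cone C y"
proof -
  obtain s0 where "s0 \<in> subdifferential_on S f y"
    using convex_on_interior_subgradient[OF f y] .
  then have s0: "y \<in> S" "\<And>z. z \<in> S \<Longrightarrow> f y + s0 * (z - y) \<le> f z"
    by (auto simp: subdifferential_on_def)
  have yC: "y \<in> C" using s by (auto simp: subdifferential_on_def)
  have dir: "f y + s * (z - y) \<le> f z" if "u \<in> C" "z \<in> S" "0 < (u - y) * (z - y)" for u z
    using convex_on_subgradient_ray[OF f C s that] .
  have weaken: "f y + s1 * (z - y) \<le> f z" if "f y + s2 * (z - y) \<le> f z" "0 \<le> (s2 - s1) * (z - y)"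
    for s1 s2 z
    using that by (simp add: algebra_simps)
  define R L where "R \<longleftrightarrow> (\<exists>u\<in>C. y < u)" and "L \<longleftrightarrow> (\<exists>u\<in>C. u < y)"
  have right: "f y + s * (z - y) \<le> f z" if "R" "z \<in> S" "y < z" for z
    using that dir by (auto simp: R_def zero_less_mult_iff)
  have left: "f y + s * (z - y) \<le> f z" if "L" "z \<in> S" "z < y" for z
    using that dir by (auto simp: L_def zero_less_mult_iff)
  \<comment> \<open>On a side of \<open>y\<close> where \<open>C\<close> has points,
    \<open>s\<close> already supports \<open>f\<close> on all of \<open>S\<close>. If
    \<open>C\<close> lies only to the right, raising the slope to at least \<open>s0\<close> settles
    the left side, and \<open>s - s'\<close> is nonpositive, hence normal; the other side is
    symmetric. If \<open>C\<close> is the single point \<open>y\<close>, every number is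
    normal.\<close>
  define s' where "s' = (if R then if L then s else max s s0 else if L then min s s0 else s0)"
  show ?thesis
  proof (rule that)
    have "f y + s' * (z - y) \<le> f z" if z: "z \<in> S" for z
    proof (cases z y rule: linorder_cases)
      case greater
      show ?thesis
        by (cases "R \<and> s' = s")
          (use right z greater in blast,
           rule weaken[OF s0(2)[OF z]],
           use greater in \<open>auto simp: s'_def max_def min_def zero_le_mult_iff split: if_splits\<close>)
    next
      case less
      show ?thesis
        by (cases "L \<and> s' = s")
          (use left z less in blast,
           rule weaken[OF s0(2)[OF z]],
           use less in \<open>auto simp: s'_def max_def min_def zero_le_mult_iff split: if_splits\<close>)
    qed simp
    then show "s' \<in> subdifferential_on S f y"
      using s0(1) by (auto simp: subdifferential_on_def)
    have "(s - s') * (z - y) \<le> 0" if z: "z \<in> C" for z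
    proof (cases z y rule: linorder_cases)
      case greater
      then have R using z by (auto simp: R_def)
      with greater show ?thesis by (auto simp: s'_def mult_le_0_iff)
    next
      case less
      then have L using z by (auto simp: L_def)
      with less show ?thesis by (auto simp: s'_def mult_le_0_iff)
    qed simp
    then show "s - s' \<in> normal_cone C y"
      using yC by (auto simp: normal_cone_def)
  qed
qed

text \<open>Subtracting the supporting line of slope \<open>s\<close> leaves a function with a local
  minimum at \<open>y\<close>, whose derivative there vanishes.\<close>

lemma subdifferential_on_has_derivative:
  fixes f :: "real \<Rightarrow> real"
  assumes s: "s \<in> subdifferential_on S f y" and y: "y \<in> interior S"
    and D: "(f has_real_derivative D) (at y)"
  shows "D = s"
proof -
  obtain d where d: "d > 0" "ball y d \<subseteq> S"
    using y mem_interior by blast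
  have "((\<lambda>z. f z - s * (z - y)) has_real_derivative D - s) (at y)"
    using D by (auto intro!: derivative_eq_intros)
  moreover have "\<forall>z. \<bar>y - z\<bar> < d \<longrightarrow> f y - s * (y - y) \<le> f z - s * (z - y)"
    using s d(2) by (force simp: subdifferential_on_def ball_def dist_real_def)
  ultimately have "D - s = 0"
    using DERIV_local_min d(1) by blast
  then show ?thesis by simp
qed

text \<open>\<open>L\<close> need not be differentiable here: a continuous selection \<open>G\<close> of its subgradients plays
  the role of the derivative.\<close>

lemma minimizer_sum_subgradient:
  fixes L X G :: "real \<Rightarrow> real"
  assumes X: "convex_on S X" and C: "C \<subseteq> S" "convex C"
    and L: "\<And>u v. u \<in> C \<Longrightarrow> v \<in> C \<Longrightarrow> L u + G u * (v - u) \<le> L v"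
    and G: "continuous_on UNIV G"
    and y: "y \<in> C" "\<And>z. z \<in> C \<Longrightarrow> c * y + L y + X y \<le> c * z + L z + X z"
  shows "- c - G y \<in> subdifferential_on C X y"
proof -
  have "X y + (- c - G y) * (z - y) \<le> X z" if z: "z \<in> C" for z
  proof -
    have "0 \<le> (c + G (y + t * (z - y))) * (z - y) + (X z - X y)" if t: "0 < t" "t < 1" for t
    proof -
      define w where "w = y + t * (z - y)"
      have w_eq: "w = (1 - t) *\<^sub>R y + t *\<^sub>R z" by (simp add: w_def algebra_simps)
      then have w: "w \<in> C"
        using convexD_alt[OF C(2) y(1) z] t by simp
      have "X w \<le> (1 - t) * X y + t * X z"
        using convex_onD[OF X, of t y z] t y(1) z C(1) w_eq by auto
      \<comment> \<open>The subgradient is taken at the moving point \<open>w\<close> and tested at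
        \<open>y\<close>: this bounds \<open>L w - L y\<close> from above, and continuity of
        \<open>G\<close> brings \<open>G w\<close> back to \<open>G y\<close> in the limit.\<close>
      moreover have "L w - t * (G w * (z - y)) \<le> L y"
        using L[OF w y(1)] by (simp add: w_def algebra_simps)
      moreover have "c * y + L y + X y \<le> c * w + L w + X w"
        by (rule y(2)[OF w])
      moreover have "c * w = c * y + t * (c * (z - y))"
        by (simp add: w_def algebra_simps)
      ultimately have "0 \<le> t * ((c + G w) * (z - y) + (X z - X y))"
        by (simp add: algebra_simps)
      with t show ?thesis by (simp add: w_def zero_le_mult_iff)
    qed
    then have ev: "\<forall>\<^sub>F t in at_right 0. 0 \<le> (c + G (y + t * (z - y))) * (z - y) + (X z - X y)"
      by (auto simp: eventually_at_right_field intro!: exI[of _ 1])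
    have "continuous_on UNIV (\<lambda>t. (c + G (y + t * (z - y))) * (z - y) + (X z - X y))"
      by (intro continuous_intros continuous_on_compose2[OF G]) auto
    then have "isCont (\<lambda>t. (c + G (y + t * (z - y))) * (z - y) + (X z - X y)) 0"
      by (simp add: continuous_on_eq_continuous_at)
    then have "((\<lambda>t. (c + G (y + t * (z - y))) * (z - y) + (X z - X y))
        \<longlongrightarrow> (c + G y) * (z - y) + (X z - X y)) (at_right 0)"
      by (auto simp: isCont_def intro: filterlim_mono[OF _ order_refl at_le])
    then have "0 \<le> (c + G y) * (z - y) + (X z - X y)"
      by (rule tendsto_lowerbound[OF _ ev]) simp
    then show ?thesis by (simp add: algebra_simps)
  qed
  with y(1) show ?thesis by (simp add: subdifferential_on_def)
qed


section \<open>The expected stage cost\<close>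

text \<open>For each demand \<open>d\<close> the slope \<open>h\<close> if \<open>d \<le> u\<close>,
  and \<open>- b\<close> otherwise, is a subgradient of the stage cost at \<open>u\<close>, also at
  the kink \<open>d = u\<close>. Its expectation is the factor of \<open>v - u\<close>.\<close>

lemma (in real_distribution) newsvendor_subgradient:
  fixes h b u v :: real
  assumes hb: "0 \<le> h" "0 \<le> b"
    and int: "integrable M (\<lambda>d. h * max (u - d) 0 + b * max (d - u) 0)"
      "integrable M (\<lambda>d. h * max (v - d) 0 + b * max (d - v) 0)"
  shows "(\<integral>d. (h * max (u - d) 0 + b * max (d - u) 0) \<partial>M)
           + (h * cdf M u - b * (1 - cdf M u)) * (v - u)
         \<le> (\<integral>d. (h * max (v - d) 0 + b * max (d - v) 0) \<partial>M)"
proof -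
  have ind: "integrable M (indicator {..u} :: real \<Rightarrow> real)"
    by (simp add: integrable_indicator_iff emeasure_eq_measure)
  have "(\<integral>d. (h * max (u - d) 0 + b * max (d - u) 0) \<partial>M)
           + (h * cdf M u - b * (1 - cdf M u)) * (v - u)
      = (\<integral>d. (h * max (u - d) 0 + b * max (d - u) 0)
            + ((h + b) * (v - u) * indicator {..u} d - b * (v - u)) \<partial>M)"
    using int(1) ind prob_space by (simp add: cdf_def) (simp add: algebra_simps)
  also have "\<dots> \<le> (\<integral>d. (h * max (v - d) 0 + b * max (d - v) 0) \<partial>M)"
  proof (rule integral_mono)
    show "integrable M (\<lambda>d. (h * max (u - d) 0 + b * max (d - u) 0)
            + ((h + b) * (v - u) * indicator {..u} d - b * (v - u)))"
      using int(1) ind by simp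
    show "(h * max (u - d) 0 + b * max (d - u) 0)
            + ((h + b) * (v - u) * indicator {..u} d - b * (v - u))
          \<le> h * max (v - d) 0 + b * max (d - v) 0" for d
    proof -
      have "h * (v - d) \<le> h * max (v - d) 0" "b * (d - v) \<le> b * max (d - v) 0"
        "0 \<le> h * max (v - d) 0" "0 \<le> b * max (d - v) 0"
        using hb by (auto intro: mult_left_mono)
      then show ?thesis
        by (cases "d \<le> u") (auto simp: algebra_simps max_def)
    qed
  qed (use int in auto)
  finally show ?thesis .
qed


section \<open>Optimal deployment\<close>

lemma well_formed_model_real_distribution:
  assumes "well_formed_model M" "r \<in> {1..horizon M}" "m \<in> beliefs M r"
  shows "real_distribution (demand_law M r m)"
proof -
  have "demand_law M r \<in> restrict_space borel (beliefs M r) \<rightarrow>\<^sub>M prob_algebra borel"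
    using assms by (simp add: well_formed_model_def)
  then have "demand_law M r m \<in> space (prob_algebra borel)"
    using assms(3) by (auto simp: space_restrict_space dest: measurable_space)
  then show ?thesis
    by (auto simp: space_prob_algebra real_distribution_def real_distribution_axioms_def
        dest: sets_eq_imp_space_eq)
qed

lemma well_formed_model_integrable_stage_cost:
  assumes M: "well_formed_model M" "r \<in> {1..horizon M}" "m \<in> beliefs M r" and y: "0 \<le> y"
  shows "integrable (demand_law M r m)
    (\<lambda>d. idle_cost M * max (y - d) 0 + shortage_cost M * max (d - y) 0)"
proof -
  have "0 < max_deploy M r"
    using M by (simp add: well_formed_model_def)
  \<comment> \<open>Zero deployment is feasible, so finiteness of the operating cost can be read off
    at initial capacity \<open>y\<close> with \<open>q = 0\<close>.\<close>
  then have "0 \<in> deployments M r"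
    by (simp add: deployments_def zero_ereal_def[symmetric])
  then have "integrable (demand_law M r m) (operating_cost M y 0)"
    using M y by (auto simp: well_formed_model_def)
  then show ?thesis by (simp add: operating_cost_def[abs_def])
qed

text \<open>Finiteness of both expectations allows the Bellman integral to be split into stage cost
  and continuation; the rest is \<open>q = (I + q) - I\<close> in the linear cost.\<close>

lemma objective_eq_Phi:
  assumes M: "well_formed_model M" "r \<in> {1..horizon M}" "m \<in> beliefs M r" and y: "0 \<le> I + q"
  shows "objective M r a m I q = Phi M r a m (I + q) - unit_cost M r * I"
proof -
  have "integrable (demand_law M r m) (next_value M r (val_fn M (Suc r) a) m (I + q))"
    using M y by (simp add: well_formed_model_def)
  then show ?thesis
    using well_formed_model_integrable_stage_cost[OF M y]
    by (simp add: objective_def stage_objective_def Phi_def Xi_def operating_cost_def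
        diff_diff_eq right_diff_distrib distrib_left)
qed

theorem corollary1:
  fixes M :: service_model and r :: nat and a :: bool and m I :: real
  assumes model: "well_formed_model M"
    and B1: "\<forall>r\<in>{1..horizon M}. \<forall>m\<in>beliefs M r. \<forall>a.
      lsc_on {0..} (Phi M r a m) \<and> convex_on {0..} (Phi M r a m) \<and>
      (\<exists>y. is_arg_min (Phi M r a m) (\<lambda>z. z \<in> {0..}) y)"
    and B2: "\<forall>r\<in>{1..horizon M}. \<forall>m\<in>beliefs M r. continuous_on UNIV (demand_cdf M r m)"
    and B3: "\<forall>r\<in>{1..horizon M}. \<forall>m\<in>beliefs M r. \<forall>a.
      convex_on {0..} (Xi M r a m) \<and>
      (\<forall>y>0. \<not> Xi M r a m differentiable (at y) \<longrightarrow>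
         subdifferential_on {0..} (Xi M r a m) y \<noteq> {})"
    and r: "r \<in> {1..horizon M}"
    and m: "m \<in> beliefs M r"
    and I: "0 \<le> I"
  shows
    "is_smallest_minimizer (Phi M r a m) {0..} (target M r a m) \<and>
     is_smallest_minimizer (objective M r a m I) (deployments M r) (opt_deployment M r a m I) \<and>
     (\<forall>qbar. max_deploy M r = ereal qbar \<longrightarrow>
        opt_deployment M r a m I = min qbar (max (target M r a m - I) 0)) \<and>
     (max_deploy M r = \<infinity> \<longrightarrow> opt_deployment M r a m I = max (target M r a m - I) 0) \<and>
     is_smallest_minimizer (objective M r a m I) {0..} (max (target M r a m - I) 0) \<and>
     (\<forall>\<xi>. 0 < target M r a m \<longrightarrow>
        (Xi M r a m has_real_derivative \<xi>) (at (target M r a m)) \<longrightarrow>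
        0 < shortage_cost M + idle_cost M \<longrightarrow>
        (shortage_cost M - unit_cost M r - \<xi>) / (shortage_cost M + idle_cost M) \<in> {0..1} \<longrightarrow>
        demand_cdf M r m (target M r a m) =
          (shortage_cost M - unit_cost M r - \<xi>) / (shortage_cost M + idle_cost M)) \<and>
     (0 < target M r a m \<longrightarrow> \<not> Xi M r a m differentiable (at (target M r a m)) \<longrightarrow>
        0 \<in> {unit_cost M r + idle_cost M * demand_cdf M r m (target M r a m)
               - shortage_cost M * (1 - demand_cdf M r m (target M r a m)) + s |
             s. s \<in> subdifferential_on {0..} (Xi M r a m) (target M r a m)}) \<and>
     (target M r a m = 0 \<longrightarrow>
        0 \<in> {unit_cost M r + idle_cost M * demand_cdf M r m 0
               - shortage_cost M * (1 - demand_cdf M r m 0) + s + n |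
             s n. s \<in> subdifferential_on {0..} (Xi M r a m) 0 \<and> n \<in> normal_cone {0..} 0}) \<and>
     (\<forall>y. y = I + opt_deployment M r a m I \<longrightarrow> y \<in> frontier (capacity_levels M r I) \<longrightarrow>
        0 \<in> {unit_cost M r + idle_cost M * demand_cdf M r m y
               - shortage_cost M * (1 - demand_cdf M r m y) + s + n |
             s n. s \<in> subdifferential_on {0..} (Xi M r a m) y \<and>
                  n \<in> normal_cone (capacity_levels M r I) y})"
proof -
  let ?h = "idle_cost M" and ?b = "shortage_cost M" and ?c = "unit_cost M r"
  let ?F = "demand_cdf M r m" and ?X = "Xi M r a m" and ?P = "Phi M r a m"
  let ?y = "target M r a m" and ?q = "opt_deployment M r a m I"
  let ?C = "capacity_levels M r I"
  define G where "G y = ?h * ?F y - ?b * (1 - ?F y)" for y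
  define L where "L y = (\<integral>d. (?h * max (y - d) 0 + ?b * max (d - y) 0) \<partial>demand_law M r m)" for y
  interpret D: real_distribution "demand_law M r m"
    using model r m by (rule well_formed_model_real_distribution)
  have lsc: "lsc_on {0..} ?P" and P: "convex_on {0..} ?P" and X: "convex_on {0..} ?X"
    and ex: "\<exists>y. is_arg_min ?P (\<lambda>z. z \<in> {0..}) y"
    using B1 B3 r m by blast+
  have hb: "0 \<le> ?h" "0 \<le> ?b" and qpos: "0 < max_deploy M r"
    using model r by (auto simp: well_formed_model_def)
  have P_eq: "?P y = ?c * y + L y + ?X y" for y
    by (simp add: Phi_def L_def)
  have obj: "objective M r a m I q = ?P (I + q) - ?c * I" if "0 \<le> q" for q
    using objective_eq_Phi[OF model r m] I that by simp

  \<comment> \<open>Base-stock formula\<close>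
  have y: "is_smallest_minimizer ?P {0..} ?y"
    using ex lsc_on_smallest_minimizer[OF lsc] by (auto simp: target_def)
  have C_cases: "(\<exists>qbar>0. max_deploy M r = ereal qbar \<and> ?C = {I..I + qbar}) \<or>
      max_deploy M r = \<infinity> \<and> ?C = {I..}"
    using qpos by (cases "max_deploy M r")
      (auto simp: capacity_levels_bounded capacity_levels_unbounded)
  \<comment> \<open>The projection of the target onto the feasible capacities. The unbounded case is
    separate because \<open>real_of_ereal\<close> sends \<open>\<infinity>\<close> to 0.\<close>
  define p where "p = (if max_deploy M r = \<infinity> then max ?y I
    else min (I + real_of_ereal (max_deploy M r)) (max ?y I))"
  have p: "is_smallest_minimizer ?P ?C p"
    using C_cases convex_smallest_minimizer_atLeast[OF P y I]
      convex_smallest_minimizer_atLeastAtMost[OF P y I] by (auto simp: p_def)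
  have "is_smallest_minimizer (objective M r a m I) (deployments M r) (p - I)"
    using p unfolding capacity_levels_def
    by (rule is_smallest_minimizer_translate) (simp add: obj deployments_def)
  then have q: "is_smallest_minimizer (objective M r a m I) (deployments M r) ?q"
    and q_eq: "?q = p - I"
    using smallest_minimizer_eq by (auto simp: opt_deployment_def)
  have img: "(\<lambda>q. I + q) ` {0..} = {I..}"
    by (force simp: image_iff intro: exI[of _ "_ - I"])
  \<comment> \<open>Here the bound is dropped at review \<open>r\<close> only; the later value
    functions stay those of \<open>M\<close>.\<close>
  have unb: "is_smallest_minimizer (objective M r a m I) {0..} (max (?y - I) 0)"
    using is_smallest_minimizer_translate[of ?P I "{0..}" "max ?y I" "objective M r a m I" "?c * I"]
      convex_smallest_minimizer_atLeast[OF P y I] obj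
    by (simp add: img max_diff_distrib_left)

  \<comment> \<open>First-order conditions\<close>
  have contG: "continuous_on UNIV G"
    unfolding G_def using B2 r m by (intro continuous_intros) auto
  have subG: "L u + G u * (v - u) \<le> L v" if "0 \<le> u" "0 \<le> v" for u v
    unfolding L_def G_def
    using that by (intro D.newsvendor_subgradient hb
        well_formed_model_integrable_stage_cost[OF model r m])
  \<comment> \<open>Used for the target over \<open>{0..}\<close> and for the implemented level
    \<open>p\<close> over the feasible capacities.\<close>
  have fonc: "- ?c - G x \<in> subdifferential_on C ?X x"
    if "is_smallest_minimizer ?P C x" "C \<subseteq> {0..}" "convex C" for x C
    using that
    by (intro minimizer_sum_subgradient[OF X _ _ _ contG, where L = L] subG)
      (auto simp: is_smallest_minimizer_iff P_eq)
  have y_sub: "- ?c - G ?y \<in> subdifferential_on {0..} ?X ?y"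
    using y by (rule fonc) auto
  have p_sub: "- ?c - G p \<in> subdifferential_on ?C ?X p"
    using p by (rule fonc) (use C_cases I in auto)

  have fractile: "?F ?y = (?b - ?c - \<xi>) / (?b + ?h)"
    if "0 < ?y" "(?X has_real_derivative \<xi>) (at ?y)" "0 < ?b + ?h" for \<xi>
  proof -
    have "\<xi> = - ?c - G ?y"
      using subdifferential_on_has_derivative[OF y_sub _ that(2)] that(1) by simp
    then show ?thesis using that(3) by (simp add: G_def field_simps)
  qed
  \<comment> \<open>The slope from \<open>p_sub\<close> supports the continuation term on
    \<open>?C\<close> only. The sum rule splits it at interior points of \<open>{0..}\<close>, so
    \<open>p = 0\<close> is treated apart.\<close>
  have "\<exists>s n. 0 = ?c + G p + s + n \<and> s \<in> subdifferential_on {0..} ?X p \<and> n \<in> normal_cone ?C p"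
  proof (cases "p = 0")
    case True
    have pC: "p \<in> ?C" using p by (simp add: is_smallest_minimizer_iff)
    \<comment> \<open>Now \<open>?C\<close> starts at 0 and contains a positive \<open>u\<close>, so
      the ray argument extends the subgradient to all of \<open>{0..}\<close>, and the normal vector
      is 0.\<close>
    then have "I = 0" using C_cases I True by auto
    then obtain u where u: "u \<in> ?C" "0 < u"
      using C_cases by (metis add_0 atLeastAtMost_iff atLeast_iff less_imp_le order_refl zero_less_one)
    have "?X p + (- ?c - G p) * (z - p) \<le> ?X z" if "0 \<le> z" for z
    proof (cases "z = p")
      case False
      with that True u show ?thesis
        by (intro convex_on_subgradient_ray[OF X _ _ p_sub u(1)])
          (use C_cases I in \<open>auto simp: is_interval_cc is_interval_ci\<close>)
    qed simp
    then have "- ?c - G p \<in> subdifferential_on {0..} ?X p"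
      using True by (simp add: subdifferential_on_def)
    moreover have "0 \<in> normal_cone ?C p"
      using pC by (simp add: normal_cone_def)
    ultimately show ?thesis by force
  next
    case False
    have "?C \<subseteq> {0..}" "is_interval ?C" "p \<in> interior {0..}"
      using C_cases I p False by (auto simp: is_smallest_minimizer_iff is_interval_cc is_interval_ci)
    from subdifferential_on_add_normal_cone[OF X this p_sub] obtain s'
      where "s' \<in> subdifferential_on {0..} ?X p" "- ?c - G p - s' \<in> normal_cone ?C p" .
    then show ?thesis by force
  qed
  then have boundary: "0 \<in> {?c + ?h * ?F p - ?b * (1 - ?F p) + s + n |
      s n. s \<in> subdifferential_on {0..} ?X p \<and> n \<in> normal_cone ?C p}"
    by (auto simp: G_def algebra_simps)
  have kink: "0 \<in> {?c + ?h * ?F ?y - ?b * (1 - ?F ?y) + s | s. s \<in> subdifferential_on {0..} ?X ?y}"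
    using y_sub by (force simp: G_def)
  have zero: "0 \<in> {?c + ?h * ?F 0 - ?b * (1 - ?F 0) + s + n |
      s n. s \<in> subdifferential_on {0..} ?X 0 \<and> n \<in> normal_cone {0..} 0}" if "?y = 0"
  proof -
    \<comment> \<open>The subdifferential at 0 belongs to the extension by infinity and so already
      accounts for the constraint; the normal vector 0 suffices.\<close>
    have "0 \<in> normal_cone {0..} 0" by (simp add: normal_cone_def)
    then show ?thesis using y_sub that by (force simp: G_def)
  qed
  have q_bounded: "?q = min qbar (max (?y - I) 0)" if "max_deploy M r = ereal qbar" for qbar
    using that by (auto simp: q_eq p_def min_def max_def)
  have q_unbounded: "?q = max (?y - I) 0" if "max_deploy M r = \<infinity>"
    using that by (auto simp: q_eq p_def max_def)
  have "I + ?q = p" by (simp add: q_eq)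
  then show ?thesis
    by (intro conjI allI impI y q q_bounded q_unbounded unb fractile kink zero)
      (simp_all only: boundary)
qed

end
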